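(* Let $X$ be a real Hilbert space, let $U$ and $V$ be nonempty closed convex subsets of $X$, let $A=N_U$ and $B=N_V$ be their normal cone operators, and let $T=\operatorname{Id}-J_A+J_BR_A$ be the Douglas--Rachford operator associated with $(A,B)$, i.e. $T=\operatorname{Id}-P_U+P_V(2P_U-\operatorname{Id})$. Let $v=P_{\overline{\operatorname{ran}}(\operatorname{Id}-T)}(0)$ and suppose that $U\cap(v+V)\neq\varnothing$. Let $x\in X$. Then the sequence $(P_UT^nx)_{n\in\mathbb N}$ converges weakly to some point in $Z_v=U\cap(v+V)$.
   Context: $P_C$ denotes the projection onto a nonempty closed convex set $C$; $N_C$ is the normal cone operator of $C$. For a maximally monotone operator $A$, $J_A=(\operatorname{Id}+A)^{-1}$ and $R_A=2J_A-\operatorname{Id}$; here $J_{N_U}=P_U$ and $J_{N_V}=P_V$. $T$ is (firmly) nonexpansive, so $\overline{\operatorname{ran}}(\operatorname{Id}-T)$ (the closure of the range of $\operatorname{Id}-T$) is closed and convex, and $v$ is its unique element of minimal norm. The set of primal normal solutions is $Z_v=\{x\in X : 0\in Ax-v+B(x-v)\}$. *)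

theory Defs
  imports "HOL-Analysis.Analysis"
begin

(* A real Hilbert space is a type of sort {real_inner, complete_space}.
   A set-valued operator on X is a function from X to sets of points of X. *)

(* closest_point from the library lives on heine_borel spaces only, which excludes
   infinite-dimensional Hilbert spaces.  For a nonempty closed convex set C the
   minimizer exists and is unique. *)
definition proj :: "'a::real_inner set \<Rightarrow> 'a \<Rightarrow> 'a"
  where "proj C x = (THE p. p \<in> C \<and> (\<forall>y\<in>C. dist x p \<le> dist x y))"

definition normal_cone :: "'a::real_inner set \<Rightarrow> 'a \<Rightarrow> 'a set"
  where "normal_cone C x =
    (if x \<in> C then {u. \<forall>y\<in>C. inner u (y - x) \<le> 0} else {})"

(* J = (Id + A)^{-1}, that is, J x is the point p with x \<in> p + A p.  It is single-valued
   and everywhere defined when A is maximally monotone, so THE denotes it. *)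
definition resolvent :: "('a::real_inner \<Rightarrow> 'a set) \<Rightarrow> 'a \<Rightarrow> 'a"
  where "resolvent A x = (THE p. x \<in> (\<lambda>u. p + u) ` A p)"

definition reflected_resolvent :: "('a::real_inner \<Rightarrow> 'a set) \<Rightarrow> 'a \<Rightarrow> 'a"
  where "reflected_resolvent A x = 2 *\<^sub>R resolvent A x - x"

definition douglas_rachford ::
    "('a::real_inner \<Rightarrow> 'a set) \<Rightarrow> ('a \<Rightarrow> 'a set) \<Rightarrow> 'a \<Rightarrow> 'a"
  where "douglas_rachford A B x =
    x - resolvent A x + resolvent B (reflected_resolvent A x)"

(* The solution set of 0 \<in> A x - v + B (x - v), with Minkowski sums of sets. *)
definition primal_normal_solutions ::
    "('a::real_inner \<Rightarrow> 'a set) \<Rightarrow> ('a \<Rightarrow> 'a set) \<Rightarrow> 'a \<Rightarrow> 'a set"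
  where "primal_normal_solutions A B v =
    {x. 0 \<in> {a - v + b | a b. a \<in> A x \<and> b \<in> B (x - v)}}"

definition weakly_converges :: "(nat \<Rightarrow> 'a::real_inner) \<Rightarrow> 'a \<Rightarrow> bool"
  where "weakly_converges s l \<longleftrightarrow> (\<forall>u. (\<lambda>n. inner (s n) u) \<longlonglongrightarrow> inner l u)"

lemma closest_iff_normal:
  fixes C :: "'a::real_inner set"
  assumes "convex C" "p \<in> C"
  shows "(\<forall>y\<in>C. dist x p \<le> dist x y) \<longleftrightarrow> (\<forall>y\<in>C. inner (x - p) (y - p) \<le> 0)"
proof
  assume min: "\<forall>y\<in>C. dist x p \<le> dist x y"
  show "\<forall>y\<in>C. inner (x - p) (y - p) \<le> 0"
  proof (intro ballI, rule ccontr)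
    fix y assume y: "y \<in> C" and "\<not> inner (x - p) (y - p) \<le> 0"
    then have "inner (x - p) (y - p) > 0" by simp
    from closer_point_lemma[OF this] obtain u where
      u: "u > 0" "u \<le> 1" "dist (p + u *\<^sub>R (y - p)) x < dist p x" by blast
    have "p + u *\<^sub>R (y - p) = (1 - u) *\<^sub>R p + u *\<^sub>R y"
      by (simp add: algebra_simps)
    also have "\<dots> \<in> C"
      using assms y u by (intro convexD) auto
    finally show False
      using min u(3) by (auto simp: dist_commute not_less[symmetric])
  qed
next
  assume normal: "\<forall>y\<in>C. inner (x - p) (y - p) \<le> 0"
  show "\<forall>y\<in>C. dist x p \<le> dist x y"
  proof
    fix y assume "y \<in> C"
    then have "inner (x - p) (y - p) \<le> 0" using normal by blast
    moreover have "inner (x - y) (x - y) =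
        inner (x - p) (x - p) - 2 * inner (x - p) (y - p) + inner (y - p) (y - p)"
      by (simp add: inner_diff_left inner_diff_right inner_commute)
    ultimately have "inner (x - p) (x - p) \<le> inner (x - y) (x - y)"
      using inner_ge_zero[of "y - p"] by linarith
    then show "dist x p \<le> dist x y"
      by (simp add: dist_norm norm_le)
  qed
qed

lemma resolvent_normal_cone:
  assumes "convex C"
  shows "resolvent (normal_cone C) = proj C"
proof
  fix x
  have "x \<in> (\<lambda>u. p + u) ` normal_cone C p \<longleftrightarrow>
      p \<in> C \<and> (\<forall>y\<in>C. dist x p \<le> dist x y)" for p
  proof -
    have "x \<in> (\<lambda>u. p + u) ` normal_cone C p \<longleftrightarrow> x - p \<in> normal_cone C p"
      by (auto simp: image_iff algebra_simps intro: bexI[of _ "x - p"])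
    then show ?thesis
      using closest_iff_normal[OF assms, of p x] by (auto simp: normal_cone_def)
  qed
  then show "resolvent (normal_cone C) x = proj C x"
    by (simp add: resolvent_def proj_def)
qed

lemma douglas_rachford_normal_cone:
  assumes "convex U" "convex V"
  shows "douglas_rachford (normal_cone U) (normal_cone V) x =
    x - proj U x + proj V (2 *\<^sub>R proj U x - x)"
  by (simp add: douglas_rachford_def reflected_resolvent_def resolvent_normal_cone assms)

end

theory Submission
  imports Defs
begin

text \<open>
  The vector \<open>v\<close> is the element of least norm of \<open>closure (U - V)\<close>: points \<open>u \<in> U\<close> have
  displacement \<open>u - P\<^sub>V u\<close>, which is at least as short as any \<open>u - w\<close> with \<open>w \<in> V\<close>.
  Put \<open>y\<^sub>n = T\<^sup>n x + n v\<close>, \<open>p\<^sub>n = P\<^sub>U (T\<^sup>n x)\<close>, \<open>q\<^sub>n = P\<^sub>V (2 p\<^sub>n - T\<^sup>n x)\<close>.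
  For \<open>z \<in> U \<inter> (v + V)\<close> the variational inequalities of the projections show that
  \<open>norm (y\<^sub>n - z)\<close> decreases, \<open>p\<^sub>n - q\<^sub>n \<rightarrow> v\<close> and \<open>\<langle>p\<^sub>n - z, y\<^sub>n - p\<^sub>n\<rangle> \<rightarrow> 0\<close>.
  Subtracting these relations for two such points \<open>a\<close>, \<open>b\<close> shows that \<open>\<langle>p\<^sub>n, a - b\<rangle>\<close> converges,
  so that \<open>p\<^sub>n\<close> can have only one weak cluster point.  Weak compactness
  is replaced by the fact that decreasing bounded closed convex sets have a common point, applied
  to closed convex hulls of tails.
\<close>

section \<open>Nested closed convex sets\<close>

text \<open>Points \<open>m n\<close> of almost least norm in \<open>C n\<close> form a Cauchy
  sequence, and their limit lies in every \<open>C n\<close>. Boundedness is what makes the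
  increasing infima \<open>s n\<close> converge.\<close>

lemma decseq_closed_convex_Inter_nonempty:
  fixes C :: "nat \<Rightarrow> 'a::{real_inner, complete_space} set"
  assumes cl: "\<And>n. closed (C n)" and cv: "\<And>n. convex (C n)" and ne: "\<And>n. C n \<noteq> {}"
    and dec: "decseq C" and bd: "bounded (C 0)"
  shows "(\<Inter>n. C n) \<noteq> {}"
proof -
  define s where "s n = (INF y\<in>C n. (norm y)\<^sup>2)" for n
  define r where "r n = 1 / real (Suc n)" for n
  have bb: "bdd_below ((\<lambda>y. (norm y)\<^sup>2) ` C n)" for n
    by (intro bdd_belowI[of _ 0]) auto
  have s_le: "s n \<le> (norm y)\<^sup>2" if "y \<in> C n" for n y
    unfolding s_def using bb that by (rule cINF_lower)
  have sub: "C k \<subseteq> C n" if "n \<le> k" for n k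
    using dec that by (simp add: decseq_def)
  have inc: "incseq s"
    unfolding incseq_def s_def using ne bb sub by (intro allI impI cINF_superset_mono) auto
  obtain B where B: "\<And>y. y \<in> C 0 \<Longrightarrow> norm y \<le> B"
    using bd by (auto simp: bounded_iff)
  have "s n \<le> B\<^sup>2" for n
  proof -
    obtain y where y: "y \<in> C n" using ne[of n] by blast
    then have "norm y \<le> B" using sub[of 0 n] B by auto
    then have "(norm y)\<^sup>2 \<le> B\<^sup>2" by (intro power_mono) auto
    then show ?thesis using s_le[OF y] by linarith
  qed
  then obtain L where L: "s \<longlonglongrightarrow> L" and sL: "\<And>n. s n \<le> L"
    using incseq_convergent[OF inc] by metis
  have "\<exists>y\<in>C n. (norm y)\<^sup>2 < s n + r n" for n
  proof -
    have "s n < s n + r n" by (simp add: r_def)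
    then show ?thesis
      using cINF_less_iff[OF ne bb] unfolding s_def by blast
  qed
  then obtain m where m: "\<And>n. m n \<in> C n" "\<And>n. (norm (m n))\<^sup>2 < s n + r n"
    by metis
  \<comment> \<open>Parallelogram law: the midpoint of \<open>m n\<close> and \<open>m k\<close>
    stays in the convex set \<open>C n\<close>, so its squared norm is at least
    \<open>s n\<close>.\<close>
  have key: "(norm (m n - m k))\<^sup>2 \<le> 2 * (L - s n) + 4 * r n" if "n \<le> k" for n k
  proof -
    define c where "c = (1/2) *\<^sub>R m n + (1/2) *\<^sub>R m k"
    have "c \<in> C n"
      unfolding c_def using m(1)[of n] m(1)[of k] sub[OF that] cv[of n] by (intro convexD) auto
    then have "s n \<le> (norm c)\<^sup>2" by (rule s_le)
    moreover have "(norm (m n - m k))\<^sup>2 = 2 * (norm (m n))\<^sup>2 + 2 * (norm (m k))\<^sup>2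
        - 4 * (norm c)\<^sup>2"
      unfolding power2_norm_eq_inner c_def
      by (simp add: inner_commute algebra_simps)
    moreover have "r k \<le> r n"
      using that unfolding r_def by (intro divide_left_mono) auto
    ultimately show ?thesis using m(2)[of n] m(2)[of k] sL[of k] by argo
  qed
  have lim: "(\<lambda>n. 2 * (L - s n) + 4 * r n) \<longlonglongrightarrow> 2 * (L - L) + 4 * 0"
    unfolding r_def by (intro tendsto_intros L LIMSEQ_inverse_real_of_nat[unfolded inverse_eq_divide])
  have "Cauchy m"
  proof (rule CauchyI')
    fix e :: real assume "e > 0"
    then have "\<forall>\<^sub>F n in sequentially. 2 * (L - s n) + 4 * r n < e\<^sup>2"
      using order_tendstoD(2)[OF lim] by simp
    then obtain M where M: "\<And>n. n \<ge> M \<Longrightarrow> 2 * (L - s n) + 4 * r n < e\<^sup>2"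
      by (auto simp: eventually_sequentially)
    have "norm (m i - m j) < e" if "i \<ge> M" "j > i" for i j
    proof -
      have "(norm (m i - m j))\<^sup>2 < e\<^sup>2"
        using key[of i j] M[of i] that by linarith
      then show ?thesis using \<open>e > 0\<close> by (auto intro: power_less_imp_less_base)
    qed
    then show "\<exists>M. \<forall>i\<ge>M. \<forall>j>i. dist (m i) (m j) < e" by (auto simp: dist_norm)
  qed
  then obtain l where l: "m \<longlonglongrightarrow> l"
    by (auto simp: Cauchy_convergent_iff convergent_def)
  have "l \<in> C n" for n
  proof (rule Lim_in_closed_set[OF cl _ _ l])
    show "\<forall>\<^sub>F k in sequentially. m k \<in> C n"
      using m(1) sub by (intro eventually_sequentiallyI[of n]) blast
  qed simp
  then show ?thesis by blast
qed

section \<open>Projections in Hilbert space\<close>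

lemma proj_eqI:
  assumes "convex C" "p \<in> C" "\<And>y. y \<in> C \<Longrightarrow> inner (x - p) (y - p) \<le> 0"
  shows "proj C x = p"
  unfolding proj_def
proof (rule the_equality)
  show "p \<in> C \<and> (\<forall>y\<in>C. dist x p \<le> dist x y)"
    using assms closest_iff_normal by blast
next
  fix q assume "q \<in> C \<and> (\<forall>y\<in>C. dist x q \<le> dist x y)"
  then have "q \<in> C" "inner (x - q) (p - q) \<le> 0"
    using assms closest_iff_normal by blast+
  then have "inner (x - q) (p - q) + inner (x - p) (q - p) \<le> 0"
    using assms(3)[of q] by linarith
  also have "inner (x - q) (p - q) + inner (x - p) (q - p) = inner (q - p) (q - p)"
    by (simp add: inner_diff_left inner_diff_right inner_commute)
  finally show "q = p" by (metis inner_gt_zero_iff not_le right_minus_eq)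
qed

text \<open>A minimiser of the distance is a common point of the sections of \<open>C\<close> by
  closed balls around \<open>x\<close> whose radii shrink to \<open>infdist x C\<close>; the slack
  \<open>1 / real (Suc n)\<close> keeps each section nonempty.\<close>

lemma proj_exists:
  fixes C :: "'a::{real_inner, complete_space} set"
  assumes "closed C" "convex C" "C \<noteq> {}"
  obtains p where "p \<in> C" "\<And>y. y \<in> C \<Longrightarrow> inner (x - p) (y - p) \<le> 0"
proof -
  define D where "D n = C \<inter> cball x (infdist x C + 1 / real (Suc n))" for n
  have "(\<Inter>n. D n) \<noteq> {}"
  proof (rule decseq_closed_convex_Inter_nonempty)
    show "closed (D n)" "convex (D n)" for n
      unfolding D_def using assms by (auto intro: convex_Int)
    show "D n \<noteq> {}" for n
    proof -
      have "infdist x C < infdist x C + 1 / real (Suc n)" by simp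
      then have "\<exists>y\<in>C. dist x y < infdist x C + 1 / real (Suc n)"
        using assms(3) cINF_less_iff[of C "dist x"] by (metis bdd_below_image_dist infdist_notempty)
      then show ?thesis by (force simp: D_def)
    qed
    show "decseq D"
      unfolding decseq_def D_def
      by (intro allI impI Int_mono subset_refl subset_cball add_left_mono divide_left_mono) auto
    show "bounded (D 0)"
      unfolding D_def by (meson bounded_cball bounded_subset inf_le2)
  qed
  then obtain p where p: "\<And>n. p \<in> D n" by blast
  have "dist x p \<le> infdist x C"
  proof (rule LIMSEQ_le_const)
    show "(\<lambda>n. infdist x C + 1 / real (Suc n)) \<longlonglongrightarrow> infdist x C"
      using tendsto_add[OF tendsto_const LIMSEQ_inverse_real_of_nat[unfolded inverse_eq_divide],
          of "infdist x C"] by simp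
    show "\<exists>N. \<forall>n\<ge>N. dist x p \<le> infdist x C + 1 / real (Suc n)"
      using p by (auto simp: D_def)
  qed
  then have "\<forall>y\<in>C. dist x p \<le> dist x y"
    using infdist_le order_trans by blast
  moreover have "p \<in> C" using p by (auto simp: D_def)
  ultimately show thesis
    using that assms(2) closest_iff_normal by blast
qed

lemma
  fixes C :: "'a::{real_inner, complete_space} set"
  assumes "closed C" "convex C" "C \<noteq> {}"
  shows proj_in: "proj C x \<in> C"
    and proj_inner_le: "y \<in> C \<Longrightarrow> inner (x - proj C x) (y - proj C x) \<le> 0"
proof -
  obtain p where p: "p \<in> C" "\<And>y. y \<in> C \<Longrightarrow> inner (x - p) (y - p) \<le> 0"
    using proj_exists[OF assms] by metis
  then have "proj C x = p" using assms(2) by (intro proj_eqI) auto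
  with p show "proj C x \<in> C" "y \<in> C \<Longrightarrow> inner (x - proj C x) (y - proj C x) \<le> 0"
    by auto
qed

section \<open>Weak convergence through convex hulls of tails\<close>

text \<open>A closed half-space that contains a tail contains its closed convex hull. Common points
  of these hulls take the place of weak cluster points.\<close>

lemma inner_le_of_tail_hulls:
  fixes p :: "nat \<Rightarrow> 'a::real_inner"
  assumes y: "\<And>n. y \<in> closure (convex hull (p ` {n..}))"
    and ev: "\<forall>\<^sub>F n in sequentially. inner (p n) h \<le> c"
  shows "inner y h \<le> c"
proof -
  obtain N where N: "\<And>n. n \<ge> N \<Longrightarrow> inner (p n) h \<le> c"
    using ev by (auto simp: eventually_sequentially)
  have "closure (convex hull (p ` {N..})) \<subseteq> {y. inner h y \<le> c}"
    using N by (intro closure_minimal hull_minimal convex_halfspace_le closed_Collect_le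
        continuous_intros) (auto simp: inner_commute)
  then show ?thesis using y[of N] by (auto simp: inner_commute)
qed

lemma inner_eq_of_tail_hulls:
  fixes p :: "nat \<Rightarrow> 'a::real_inner"
  assumes y: "\<And>n. y \<in> closure (convex hull (p ` {n..}))"
    and L: "(\<lambda>n. inner (p n) h) \<longlonglongrightarrow> L"
  shows "inner y h = L"
proof (rule antisym)
  show "inner y h \<le> L"
  proof (rule field_le_epsilon)
    fix e :: real assume "e > 0"
    with L have "\<forall>\<^sub>F n in sequentially. inner (p n) h < L + e"
      by (intro order_tendstoD(2)) auto
    then show "inner y h \<le> L + e"
      by (intro inner_le_of_tail_hulls[OF y]) (auto elim: eventually_mono)
  qed
  have "inner y (- h) \<le> - L + e" if "e > 0" for e
  proof -
    from L that have "\<forall>\<^sub>F n in sequentially. inner (p n) h > L - e"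
      by (intro order_tendstoD(1)) auto
    then show "inner y (- h) \<le> - L + e"
      by (intro inner_le_of_tail_hulls[OF y]) (auto elim: eventually_mono)
  qed
  then have "inner y (- h) \<le> - L" by (rule field_le_epsilon)
  then show "L \<le> inner y h" by simp
qed

text \<open>Let \<open>z\<close> be common to all tail hulls. If \<open>inner (p n) u\<close>
  exceeded \<open>inner z u\<close> by \<open>e\<close> infinitely often, the hulls along those
  indices would also have a common point \<open>y\<close>. Convergence of
  \<open>inner (p n) (y - z)\<close> forces \<open>y = z\<close>, yet \<open>y\<close> lies in the
  half-space that excludes \<open>z\<close>.\<close>

lemma weakly_convergesI_tail_hulls:
  fixes p :: "nat \<Rightarrow> 'a::{real_inner, complete_space}"
  assumes bd: "bounded (range p)"
    and Z: "\<And>y. (\<And>n. y \<in> closure (convex hull (p ` {n..}))) \<Longrightarrow> y \<in> Z"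
    and conv: "\<And>a b. a \<in> Z \<Longrightarrow> b \<in> Z \<Longrightarrow> convergent (\<lambda>n. inner (p n) (a - b))"
  shows "\<exists>z\<in>Z. weakly_converges p z"
proof -
  \<comment> \<open>The set \<open>S\<close> selects a subsequence: \<open>UNIV\<close> yields the
    candidate limit, other choices refute a deviation from it.\<close>
  have common: "\<exists>y. \<forall>n. y \<in> closure (convex hull (p ` ({n..} \<inter> S)))"
    if S: "infinite S" for S
  proof -
    have "(\<Inter>n. closure (convex hull (p ` ({n..} \<inter> S)))) \<noteq> {}"
    proof (rule decseq_closed_convex_Inter_nonempty)
      show "closure (convex hull (p ` ({n..} \<inter> S))) \<noteq> {}" for n
        using S by (auto simp: infinite_nat_iff_unbounded_le)
      show "decseq (\<lambda>n. closure (convex hull (p ` ({n..} \<inter> S))))"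
        unfolding decseq_def by (intro allI impI closure_mono hull_mono) auto
      show "bounded (closure (convex hull (p ` ({0..} \<inter> S))))"
        by (intro bounded_closure bounded_convex_hull bounded_subset[OF bd]) auto
    qed (auto intro: convex_closure)
    then show ?thesis by blast
  qed
  obtain z where z: "\<And>n. z \<in> closure (convex hull (p ` {n..}))"
    using common[of UNIV] by auto
  have upper: "\<forall>\<^sub>F n in sequentially. inner (p n) u < inner z u + e" if "e > 0" for u e
  proof (rule ccontr)
    define S where "S = {n. inner (p n) u \<ge> inner z u + e}"
    assume "\<not> ?thesis"
    then have "infinite S"
      by (simp add: S_def not_eventually not_less frequently_cofinite flip: cofinite_eq_sequentially)
    then obtain y where y: "\<And>n. y \<in> closure (convex hull (p ` ({n..} \<inter> S)))"
      using common by blast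
    have y': "y \<in> closure (convex hull (p ` {n..}))" for n
      using y[of n] closure_mono[OF hull_mono, of "p ` ({n..} \<inter> S)" "p ` {n..}"] by blast
    obtain L where "(\<lambda>n. inner (p n) (y - z)) \<longlonglongrightarrow> L"
      using conv[OF Z[OF y'] Z[OF z]] by (auto simp: convergent_def)
    then have "inner y (y - z) = inner z (y - z)"
      using inner_eq_of_tail_hulls[OF y'] inner_eq_of_tail_hulls[OF z] by metis
    then have "inner (y - z) (y - z) = 0"
      by (simp add: inner_diff_left)
    then have "y = z" by simp
    have "closure (convex hull (p ` ({0..} \<inter> S))) \<subseteq> {y. inner u y \<ge> inner z u + e}"
      by (intro closure_minimal hull_minimal convex_halfspace_ge closed_Collect_le
          continuous_intros) (auto simp: S_def inner_commute)
    with y[of 0] \<open>y = z\<close> \<open>e > 0\<close> show False by (auto simp: inner_commute)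
  qed
  have "(\<lambda>n. inner (p n) u) \<longlonglongrightarrow> inner z u" for u
  proof (rule order_tendstoI)
    fix a assume "a < inner z u"
    then show "\<forall>\<^sub>F n in sequentially. a < inner (p n) u"
      using upper[of "inner z u - a" "- u"] by simp
  next
    fix a assume "a > inner z u"
    then show "\<forall>\<^sub>F n in sequentially. inner (p n) u < a"
      using upper[of "a - inner z u" u] by simp
  qed
  then show ?thesis using Z[OF z] by (auto simp: weakly_converges_def)
qed

section \<open>The minimal displacement vector\<close>

text \<open>The inequality is the variational one for the least-norm element \<open>v'\<close> of
  \<open>closure D\<close>, where \<open>D\<close> is the difference set of \<open>U\<close> and
  \<open>V\<close>. The range \<open>R\<close> of displacements lies in \<open>D\<close>, so
  \<open>v = v'\<close> follows once \<open>v'\<close> is shown to be in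
  \<open>closure R\<close>.\<close>

lemma min_displacement_inner_ge:
  fixes U V :: "'a::{real_inner, complete_space} set"
  assumes U: "closed U" "convex U" "U \<noteq> {}" and V: "closed V" "convex V" "V \<noteq> {}"
    and T: "\<And>x. T x = x - proj U x + proj V (2 *\<^sub>R proj U x - x)"
    and v: "v = proj (closure (range (\<lambda>y. y - T y))) 0"
    and "u \<in> U" "w \<in> V"
  shows "0 \<le> inner v (u - w - v)"
proof -
  define D where "D = (\<Union>x\<in>U. \<Union>y\<in>V. {x - y})"
  define R where "R = range (\<lambda>y. y - T y)"
  have D: "closed (closure D)" "convex (closure D)" "closure D \<noteq> {}"
    using U(3) V(3) convex_closure[OF convex_differences[OF U(2) V(2)]]
    unfolding D_def by (simp_all add: ex_in_conv)
  define v' where "v' = proj (closure D) 0"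
  have v'D: "v' \<in> closure D" unfolding v'_def by (rule proj_in[OF D])
  have v'_ge: "0 \<le> inner v' (d - v')" if "d \<in> closure D" for d
    using proj_inner_le[OF D that, of 0] by (simp add: v'_def)
  \<comment> \<open>Almost minimal norm implies closeness to \<open>v'\<close>. This serves twice:
    to approximate \<open>v'\<close> from \<open>R\<close>, and to show that the minimiser over
    \<open>closure R\<close> is unique.\<close>
  have near: "(norm (d - v'))\<^sup>2 \<le> (norm d)\<^sup>2 - (norm v')\<^sup>2" if "d \<in> closure D" for d
    using v'_ge[OF that] unfolding power2_norm_eq_inner
    by (simp add: inner_diff_left inner_diff_right inner_commute)
  have "R \<subseteq> D"
    using proj_in[OF U] proj_in[OF V] by (auto simp: R_def D_def T)
  then have RD: "closure R \<subseteq> closure D" by (rule closure_mono)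
  have v'R: "v' \<in> closure R"
    unfolding closure_approachable
  proof (intro allI impI)
    fix e :: real assume e: "e > 0"
    have "((\<lambda>t. (norm v' + t)\<^sup>2) \<longlongrightarrow> (norm v' + 0)\<^sup>2) (at_right 0)"
      by (intro tendsto_intros)
    then have "\<forall>\<^sub>F t in at_right 0. (norm v' + t)\<^sup>2 < (norm v')\<^sup>2 + e\<^sup>2"
      using e by (intro order_tendstoD(2)) auto
    \<comment> \<open>The slack \<open>t\<close> is small enough that
      \<open>norm d \<le> norm v' + t\<close> and \<open>near\<close> together put \<open>d\<close>
      within \<open>e\<close> of \<open>v'\<close>.\<close>
    then obtain t where t: "t > 0" "(norm v' + t)\<^sup>2 < (norm v')\<^sup>2 + e\<^sup>2"
      using eventually_happens'[OF _ eventually_conj[OF _ eventually_at_right_less[of 0]]]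
        trivial_limit_at_right_real by blast
    obtain a b where ab: "a \<in> U" "b \<in> V" "dist (a - b) v' < t"
      using v'D t(1) by (auto simp: closure_approachable D_def)
    \<comment> \<open>Since \<open>a\<close> is fixed by the projection onto \<open>U\<close>, this
      is the displacement \<open>a - T a\<close>, and it is no longer than
      \<open>a - b\<close>.\<close>
    define d where "d = a - proj V a"
    have "proj U a = a" using ab U by (intro proj_eqI) auto
    then have dR: "d \<in> R"
      by (auto simp: R_def T d_def image_iff scaleR_2 intro!: exI[of _ a])
    have "norm d \<le> norm (a - b)"
      using closest_iff_normal[OF V(2) proj_in[OF V], of a a] proj_inner_le[OF V] ab
      by (auto simp: d_def dist_norm)
    also have "\<dots> \<le> norm v' + t"
      using ab(3) norm_triangle_ineq2[of "a - b" v'] by (simp add: dist_norm)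
    finally have "(norm d)\<^sup>2 \<le> (norm v' + t)\<^sup>2" by (intro power_mono) auto
    then have "(norm (d - v'))\<^sup>2 < e\<^sup>2"
      using near[of d] dR RD closure_subset[of R] t(2) by fastforce
    then have "dist d v' < e"
      using e by (auto simp: dist_norm intro: power_less_imp_less_base)
    with dR show "\<exists>d\<in>R. dist d v' < e" by blast
  qed
  have "v = v'"
    unfolding v R_def[symmetric] proj_def
  proof (rule the_equality)
    have "norm v' \<le> norm d" if "d \<in> closure R" for d
    proof -
      have "(norm (d - v'))\<^sup>2 \<le> (norm d)\<^sup>2 - (norm v')\<^sup>2"
        using near that RD by blast
      then have "(norm v')\<^sup>2 \<le> (norm d)\<^sup>2"
        using zero_le_power2[of "norm (d - v')"] by linarith
      then show ?thesis by (auto intro: power2_le_imp_le)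
    qed
    then show "v' \<in> closure R \<and> (\<forall>y\<in>closure R. dist 0 v' \<le> dist 0 y)"
      using v'R by simp
  next
    fix q assume q: "q \<in> closure R \<and> (\<forall>y\<in>closure R. dist 0 q \<le> dist 0 y)"
    then have "norm q \<le> norm v'" using v'R by auto
    then have "(norm q)\<^sup>2 \<le> (norm v')\<^sup>2" by (intro power_mono) auto
    moreover have "(norm (q - v'))\<^sup>2 \<le> (norm q)\<^sup>2 - (norm v')\<^sup>2"
      using near q RD by blast
    ultimately have "(norm (q - v'))\<^sup>2 \<le> 0" by linarith
    then show "q = v'" by simp
  qed
  moreover have "u - w \<in> closure D"
    using assms(9,10) closure_subset[of D] by (auto simp: D_def)
  ultimately show ?thesis using v'_ge by auto
qed

section \<open>Normal solutions and the decrease of distances to them\<close>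

text \<open>The hypothesis makes \<open>v\<close> normal to \<open>V\<close> at
  \<open>x - v\<close>, so \<open>0\<close> and \<open>v\<close> are the witnesses:
  \<open>0 - v + v = 0\<close>.\<close>

lemma primal_normal_solutions_normal_cone:
  assumes v: "\<And>u w. u \<in> U \<Longrightarrow> w \<in> V \<Longrightarrow> 0 \<le> inner v (u - w - v)"
  shows "primal_normal_solutions (normal_cone U) (normal_cone V) v = U \<inter> ((\<lambda>y. v + y) ` V)"
proof (intro equalityI subsetI)
  fix x assume "x \<in> primal_normal_solutions (normal_cone U) (normal_cone V) v"
  then have "x \<in> U" "x - v \<in> V"
    by (auto simp: primal_normal_solutions_def normal_cone_def split: if_splits)
  then show "x \<in> U \<inter> ((\<lambda>y. v + y) ` V)"
    by (auto simp: image_iff intro!: bexI[of _ "x - v"])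
next
  fix x assume "x \<in> U \<inter> ((\<lambda>y. v + y) ` V)"
  then have x: "x \<in> U" "x - v \<in> V" by auto
  have "inner v (w - (x - v)) \<le> 0" if "w \<in> V" for w
    using v[OF x(1) that] by (simp add: inner_diff_right)
  then have "v \<in> normal_cone V (x - v)" "0 \<in> normal_cone U x"
    using x by (auto simp: normal_cone_def)
  then show "x \<in> primal_normal_solutions (normal_cone U) (normal_cone V) v"
    unfolding primal_normal_solutions_def by (force intro: exI[of _ 0] exI[of _ v])
qed

text \<open>With \<open>a = p - z\<close>, \<open>c = y - p\<close>, \<open>d = p - q - v\<close>, the squared distance drops by
  exactly \<open>2 \<langle>a, c\<rangle> + 2 \<langle>d - c, a - d\<rangle> + \<langle>d, d\<rangle>\<close>, and both inner products are
  nonnegative by the variational inequalities of the two projections.\<close>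

lemma douglas_rachford_descent:
  fixes U V :: "'a::{real_inner, complete_space} set"
  assumes U: "closed U" "convex U" "U \<noteq> {}" and V: "closed V" "convex V" "V \<noteq> {}"
    and v: "\<And>u w. u \<in> U \<Longrightarrow> w \<in> V \<Longrightarrow> 0 \<le> inner v (u - w - v)"
    and z: "z \<in> U" "z - v \<in> V" and t: "t \<ge> 0"
    and p: "p = proj U x" and q: "q = proj V (2 *\<^sub>R p - x)" and y: "y = x + t *\<^sub>R v"
  shows "0 \<le> inner (p - z) (y - p)"
    and "2 * inner (p - z) (y - p) + (norm (p - q - v))\<^sup>2
      \<le> (norm (y - z))\<^sup>2 - (norm (y - (p - q - v) - z))\<^sup>2"
proof -
  have pU: "p \<in> U" and qV: "q \<in> V"
    using proj_in[OF U] proj_in[OF V] p q by auto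
  have "inner (x - p) (z - p) \<le> 0"
    using proj_inner_le[OF U z(1)] p by auto
  moreover have "0 \<le> t * inner v (p - z)"
    using v[OF pU z(2)] t by simp
  moreover have "inner (p - z) (y - p) = t * inner v (p - z) - inner (x - p) (z - p)"
    by (simp add: y inner_diff_left inner_diff_right inner_add_left inner_add_right
        inner_commute algebra_simps)
  ultimately show a: "0 \<le> inner (p - z) (y - p)" by linarith
  have "inner (2 *\<^sub>R p - x - q) ((z - v) - q) \<le> 0"
    using proj_inner_le[OF V z(2)] q by auto
  \<comment> \<open>The shift in \<open>y\<close> contributes \<open>t\<close> copies of
    \<open>v\<close>, and \<open>p - q - v\<close> contributes one more.\<close>
  moreover have "0 \<le> (t + 1) * inner v (z - q - v)"
    using v[OF z(1) qV] t by simp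
  moreover have "inner ((p - q - v) - (y - p)) ((p - z) - (p - q - v)) =
      (t + 1) * inner v (z - q - v) - inner (2 *\<^sub>R p - x - q) ((z - v) - q)"
    by (simp add: y inner_diff_left inner_diff_right inner_add_left inner_add_right
        inner_commute algebra_simps)
  ultimately have b: "0 \<le> inner ((p - q - v) - (y - p)) ((p - z) - (p - q - v))"
    by linarith
  have id: "(norm (a + c))\<^sup>2 - (norm (a + c - d))\<^sup>2 =
      2 * inner a c + 2 * inner (d - c) (a - d) + (norm d)\<^sup>2" for a c d :: 'a
    unfolding power2_norm_eq_inner
    by (simp add: inner_diff_left inner_diff_right inner_add_left inner_add_right
        inner_commute algebra_simps)
  have e: "(p - z) + (y - p) = y - z"
    "(p - z) + (y - p) - (p - q - v) = y - (p - q - v) - z"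
    by (simp_all add: algebra_simps)
  show "2 * inner (p - z) (y - p) + (norm (p - q - v))\<^sup>2
      \<le> (norm (y - z))\<^sup>2 - (norm (y - (p - q - v) - z))\<^sup>2"
    using id[of "p - z" "y - p" "p - q - v"] b unfolding e(2) unfolding e(1) by linarith
qed

section \<open>Weak convergence of the shadow sequence\<close>

lemma douglas_rachford_shadow_weakly_converges:
  fixes U V :: "'a::{real_inner, complete_space} set"
  assumes U: "closed U" "convex U" "U \<noteq> {}" and V: "closed V" "convex V" "V \<noteq> {}"
    and T: "\<And>x. T x = x - proj U x + proj V (2 *\<^sub>R proj U x - x)"
    and v: "\<And>u w. u \<in> U \<Longrightarrow> w \<in> V \<Longrightarrow> 0 \<le> inner v (u - w - v)"
    and ne: "U \<inter> ((\<lambda>y. v + y) ` V) \<noteq> {}"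
  shows "\<exists>z \<in> U \<inter> ((\<lambda>y. v + y) ` V). weakly_converges (\<lambda>n. proj U ((T ^^ n) x)) z"
proof -
  define p where "p n = proj U ((T ^^ n) x)" for n
  define q where "q n = proj V (2 *\<^sub>R p n - (T ^^ n) x)" for n
  \<comment> \<open>Adding \<open>real n\<close> copies of \<open>v\<close> cancels the drift of the
    iterates: one step of \<open>y\<close> subtracts only \<open>d n\<close>, which tends to
    \<open>0\<close>.\<close>
  define y where "y n = (T ^^ n) x + real n *\<^sub>R v" for n
  define d where "d n = p n - q n - v" for n
  have pU: "p n \<in> U" and qV: "q n \<in> V" for n
    using proj_in[OF U] proj_in[OF V] by (auto simp: p_def q_def)
  have y_Suc: "y (Suc n) = y n - d n" for n
    by (simp add: y_def d_def p_def q_def T algebra_simps)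
  have pos: "0 \<le> inner (p n - z) (y n - p n)"
    and drop: "2 * inner (p n - z) (y n - p n) + (norm (d n))\<^sup>2
      \<le> (norm (y n - z))\<^sup>2 - (norm (y (Suc n) - z))\<^sup>2"
    if "z \<in> U" "z - v \<in> V" for z n
    using douglas_rachford_descent[OF U V v that of_nat_0_le_iff[of n] p_def q_def y_def]
    unfolding y_Suc by (simp_all add: d_def)
  have dec: "decseq (\<lambda>n. (norm (y n - z))\<^sup>2)" if "z \<in> U" "z - v \<in> V" for z
  proof (rule decseq_SucI)
    fix n show "(norm (y (Suc n) - z))\<^sup>2 \<le> (norm (y n - z))\<^sup>2"
      using pos[OF that, of n] drop[OF that, of n] zero_le_power2[of "norm (d n)"] by linarith
  qed
  have dist_conv: "convergent (\<lambda>n. (norm (y n - z))\<^sup>2)" if "z \<in> U" "z - v \<in> V" for z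
    using decseq_convergent[OF dec[OF that], of 0] by (auto simp: convergent_def)
  have drop0: "(\<lambda>n. (norm (y n - z))\<^sup>2 - (norm (y (Suc n) - z))\<^sup>2) \<longlonglongrightarrow> 0"
    if z: "z \<in> U" "z - v \<in> V" for z
  proof -
    obtain L where L: "(\<lambda>n. (norm (y n - z))\<^sup>2) \<longlonglongrightarrow> L"
      using dist_conv[OF z] by (auto simp: convergent_def)
    show ?thesis using tendsto_diff[OF L LIMSEQ_Suc[OF L]] by simp
  qed
  have inner0: "(\<lambda>n. inner (p n - z) (y n - p n)) \<longlonglongrightarrow> 0" if "z \<in> U" "z - v \<in> V" for z
  proof (rule tendsto_sandwich[OF _ _ tendsto_const drop0[OF that]])
    show "\<forall>\<^sub>F n in sequentially. inner (p n - z) (y n - p n)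
        \<le> (norm (y n - z))\<^sup>2 - (norm (y (Suc n) - z))\<^sup>2"
    proof (intro always_eventually allI)
      fix n show "inner (p n - z) (y n - p n)
        \<le> (norm (y n - z))\<^sup>2 - (norm (y (Suc n) - z))\<^sup>2"
        using pos[OF that, of n] drop[OF that, of n] zero_le_power2[of "norm (d n)"] by linarith
    qed
  qed (use pos[OF that] in auto)
  obtain z0 where z0: "z0 \<in> U" "z0 - v \<in> V" using ne by fastforce
  have d0: "d \<longlonglongrightarrow> 0"
  proof -
    have "(\<lambda>n. (norm (d n))\<^sup>2) \<longlonglongrightarrow> 0"
    proof (rule tendsto_sandwich[OF _ _ tendsto_const drop0[OF z0]])
      show "\<forall>\<^sub>F n in sequentially. (norm (d n))\<^sup>2
          \<le> (norm (y n - z0))\<^sup>2 - (norm (y (Suc n) - z0))\<^sup>2"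
      proof (intro always_eventually allI)
        fix n show "(norm (d n))\<^sup>2 \<le> (norm (y n - z0))\<^sup>2 - (norm (y (Suc n) - z0))\<^sup>2"
          using pos[OF z0, of n] drop[OF z0, of n] by linarith
      qed
    qed auto
    then show ?thesis
      using tendsto_norm_zero_cancel[of d] tendsto_real_sqrt by fastforce
  qed
  have "\<exists>z \<in> U \<inter> ((\<lambda>y. v + y) ` V). weakly_converges p z"
  proof (rule weakly_convergesI_tail_hulls)
    have "norm (p n) \<le> norm z0 + norm (y 0 - z0)" for n
    proof -
      \<comment> \<open>The cross term is nonnegative by \<open>pos\<close>, so \<open>p n\<close>
        is no farther from \<open>z0\<close> than \<open>y n\<close>.\<close>
      have "(norm (y n - z0))\<^sup>2 = (norm (p n - z0))\<^sup>2 + 2 * inner (p n - z0) (y n - p n)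
          + (norm (y n - p n))\<^sup>2"
        unfolding power2_norm_eq_inner
        by (simp add: inner_diff_left inner_diff_right inner_commute)
      then have "(norm (p n - z0))\<^sup>2 \<le> (norm (y n - z0))\<^sup>2"
        using pos[OF z0, of n] zero_le_power2[of "norm (y n - p n)"] by linarith
      also have "\<dots> \<le> (norm (y 0 - z0))\<^sup>2"
        using dec[OF z0] by (auto simp: decseq_def)
      finally have "norm (p n - z0) \<le> norm (y 0 - z0)" by (rule power2_le_imp_le) simp
      then show ?thesis using norm_triangle_sub[of "p n" z0] by linarith
    qed
    then show "bounded (range p)" by (auto simp: bounded_iff)
  next
    fix l assume l: "\<And>n. l \<in> closure (convex hull (p ` {n..}))"
    have "closure (convex hull (p ` {0..})) \<subseteq> U"
      using pU U by (intro closure_minimal hull_minimal) auto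
    then have lU: "l \<in> U" using l[of 0] by blast
    \<comment> \<open>To place \<open>l - v\<close> in \<open>V\<close>, the residual
      \<open>h\<close> of its projection is shown to vanish: \<open>p n = v + q n + d n\<close> with
      \<open>q n\<close> in \<open>V\<close> and \<open>d n\<close> tending to \<open>0\<close>, so
      testing against \<open>h\<close> gives \<open>inner h h \<le> 0\<close>.\<close>
    define w where "w = proj V (l - v)"
    define h where "h = l - v - w"
    have wV: "w \<in> V" unfolding w_def by (rule proj_in[OF V])
    have "inner l h \<le> inner (v + w) h"
    proof (rule field_le_epsilon)
      fix e :: real assume "e > 0"
      have "(\<lambda>n. inner (d n) h) \<longlonglongrightarrow> inner 0 h" by (intro tendsto_intros d0)
      then have "\<forall>\<^sub>F n in sequentially. inner (d n) h < e"
        using \<open>e > 0\<close> by (intro order_tendstoD(2)) auto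
      then have "\<forall>\<^sub>F n in sequentially. inner (p n) h \<le> inner (v + w) h + e"
      proof eventually_elim
        case (elim n)
        have "inner h (q n - w) \<le> 0"
          using proj_inner_le[OF V qV, of "l - v"] by (simp add: h_def w_def)
        moreover have "inner (p n) h = inner (v + w) h + inner h (q n - w) + inner (d n) h"
          by (simp add: d_def inner_diff_left inner_diff_right inner_add_left inner_add_right
              inner_commute)
        ultimately show ?case using elim by linarith
      qed
      then show "inner l h \<le> inner (v + w) h + e"
        by (rule inner_le_of_tail_hulls[OF l])
    qed
    then have "inner h h \<le> 0"
      by (simp add: h_def inner_diff_left inner_add_left)
    then have "h = 0" by (metis inner_gt_zero_iff not_le)
    then have "l = v + w" by (simp add: h_def algebra_simps)
    with lU wV show "l \<in> U \<inter> ((\<lambda>y. v + y) ` V)" by auto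
  next
    fix a b assume "a \<in> U \<inter> ((\<lambda>y. v + y) ` V)" "b \<in> U \<inter> ((\<lambda>y. v + y) ` V)"
    then have a: "a \<in> U" "a - v \<in> V" and b: "b \<in> U" "b - v \<in> V" by auto
    obtain K L where K: "(\<lambda>n. (norm (y n - a))\<^sup>2) \<longlonglongrightarrow> K"
      and L: "(\<lambda>n. (norm (y n - b))\<^sup>2) \<longlonglongrightarrow> L"
      using dist_conv[OF a] dist_conv[OF b] by (auto simp: convergent_def)
    \<comment> \<open>The first two terms equal \<open>inner (p n - y n) (a - b)\<close>; by
      polarization the quotient equals \<open>inner (y n) (a - b)\<close>, which restores the part
      in \<open>y n\<close>.\<close>
    have "(\<lambda>n. inner (p n - a) (y n - p n) - inner (p n - b) (y n - p n)
        + ((norm (y n - b))\<^sup>2 - (norm (y n - a))\<^sup>2 + (norm a)\<^sup>2 - (norm b)\<^sup>2) / 2)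
      \<longlonglongrightarrow> 0 - 0 + (L - K + (norm a)\<^sup>2 - (norm b)\<^sup>2) / 2"
      by (intro tendsto_intros inner0 a b K L) simp
    moreover have "inner (p n - a) (y n - p n) - inner (p n - b) (y n - p n)
        + ((norm (y n - b))\<^sup>2 - (norm (y n - a))\<^sup>2 + (norm a)\<^sup>2 - (norm b)\<^sup>2) / 2
      = inner (p n) (a - b)" for n
      unfolding power2_norm_eq_inner
      by (simp add: inner_diff_left inner_diff_right inner_commute field_simps)
    ultimately show "convergent (\<lambda>n. inner (p n) (a - b))"
      by (auto simp: convergent_def)
  qed
  then show ?thesis by (simp add: p_def[abs_def])
qed

theorem theorem5p5:
  fixes U V :: "'a::{real_inner, complete_space} set"
    and A B :: "'a \<Rightarrow> 'a set"
    and T :: "'a \<Rightarrow> 'a"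
    and v x :: 'a
  assumes "U \<noteq> {}" and "closed U" and "convex U"
    and "V \<noteq> {}" and "closed V" and "convex V"
    and "A = normal_cone U" and "B = normal_cone V"
    and "T = douglas_rachford A B"
    and "v = proj (closure (range (\<lambda>y. y - T y))) 0"
    and "U \<inter> ((\<lambda>y. v + y) ` V) \<noteq> {}"
  shows "primal_normal_solutions A B v = U \<inter> ((\<lambda>y. v + y) ` V) \<and>
    (\<exists>z \<in> primal_normal_solutions A B v.
      weakly_converges (\<lambda>n. proj U ((T ^^ n) x)) z)"
proof -
  have T: "T y = y - proj U y + proj V (2 *\<^sub>R proj U y - y)" for y
    using assms by (simp add: douglas_rachford_normal_cone)
  have v: "0 \<le> inner v (u - w - v)" if "u \<in> U" "w \<in> V" for u w
    by (rule min_displacement_inner_ge[OF assms(2,3,1,5,6,4) T assms(10) that])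
  have Z: "primal_normal_solutions A B v = U \<inter> ((\<lambda>y. v + y) ` V)"
    unfolding assms(7,8) by (rule primal_normal_solutions_normal_cone[OF v])
  show ?thesis
    unfolding Z
    using douglas_rachford_shadow_weakly_converges[OF assms(2,3,1,5,6,4) T v assms(11)]
    by blast
qed

end
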